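(* Let $\mathbb{F}$ be a field with $\operatorname{char}\mathbb{F}\neq 2$. Let $A\in M_2(\mathbb{F})$ be a nonscalar matrix (i.e. $A\notin\mathbb{F}I_2$), and set $$\tau:=\operatorname{tr}A,\qquad \delta:=\det A,\qquad \eta:=1+8\tau+64\delta.$$ Then $A\in\mathscr{P}(M_2(\mathbb{F})^+)$ and $$\ell_{M_2(\mathbb{F})^+}(A)=\begin{cases}1,&A^2=A,\\ 2,&A^2\neq A,\ 4\delta=\tau(\tau-1),\\ 3,&4\delta\neq\tau(\tau-1),\ \eta\text{ is a square in }\mathbb{F},\\ 4,&\eta\text{ is not a square in }\mathbb{F},\ \tau\neq-1/8,\\ 5,&\eta\text{ is not a square in }\mathbb{F},\ \tau=-1/8.\end{cases}$$ Here zero is included among the squares. Consequently, $w(M_2(\mathbb{F})^+)=3$ if $\mathbb{F}$ is quadratically closed, and $w(M_2(\mathbb{F})^+)=5$ otherwise.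
   Context: $M_2(\mathbb{F})^+$ is the space of $2\times2$ matrices with the Jordan product $X\circ Y=\frac12(XY+YX)$; its unit is $I_2$. A field of characteristic $\neq2$ is quadratically closed if every polynomial of degree two over it has a root in it (equivalently, every element is a square). Idempotent words: let $\mathcal{J}$ be a unital Jordan algebra with product $\circ$. An idempotent is $e\in\mathcal{J}$ with $e\circ e=e$. An idempotent word of length $m\ge 1$ is a left-nested product $(\cdots((e_1\circ e_2)\circ e_3)\circ\cdots)\circ e_m$ with all $e_i$ idempotents (for $m=1$ it is $e_1$). $\mathscr{P}(\mathcal{J})$ is the set of all values of idempotent words. For $x\in\mathscr{P}(\mathcal{J})$, $\ell_{\mathcal{J}}(x)$ is the minimal length of an idempotent word with value $x$, and $w(\mathcal{J})=\sup_{x\in\mathscr{P}(\mathcal{J})}\ell_{\mathcal{J}}(x)$. *)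

theory Defs
  imports
    "HOL-Analysis.Analysis"
    "HOL-Computational_Algebra.Computational_Algebra"
    "HOL-Library.Extended_Nat"
begin

definition jordan_mult :: "'a::field^'n^'n \<Rightarrow> 'a^'n^'n \<Rightarrow> 'a^'n^'n"  (infixl "\<circ>\<^sub>J" 70)
  where "X \<circ>\<^sub>J Y = (\<chi> i j. (1/2) * (X ** Y + Y ** X) $ i $ j)"

text \<open>
  The notions around idempotent words only involve the product of the algebra, so they are
  stated for an arbitrary binary operation on a type.
\<close>

definition idempotent_elem :: "('b \<Rightarrow> 'b \<Rightarrow> 'b) \<Rightarrow> 'b \<Rightarrow> bool"
  where "idempotent_elem p e \<longleftrightarrow> p e e = e"

text \<open>A word of length \<open>m\<close> is a nonempty list of length \<open>m\<close>; its value is the left-nested product.\<close>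

fun word_value :: "('b \<Rightarrow> 'b \<Rightarrow> 'b) \<Rightarrow> 'b list \<Rightarrow> 'b"
  where "word_value p (e # es) = foldl p e es"

definition is_idempotent_word :: "('b \<Rightarrow> 'b \<Rightarrow> 'b) \<Rightarrow> 'b list \<Rightarrow> bool"
  where "is_idempotent_word p es \<longleftrightarrow> es \<noteq> [] \<and> (\<forall>e\<in>set es. idempotent_elem p e)"

definition idempotent_products :: "('b \<Rightarrow> 'b \<Rightarrow> 'b) \<Rightarrow> 'b set"
  where "idempotent_products p = {word_value p es | es. is_idempotent_word p es}"

text \<open>Only meaningful for elements of \<^term>\<open>idempotent_products p\<close>.\<close>

definition idempotent_length :: "('b \<Rightarrow> 'b \<Rightarrow> 'b) \<Rightarrow> 'b \<Rightarrow> nat"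
  where "idempotent_length p x =
    (LEAST m. \<exists>es. is_idempotent_word p es \<and> length es = m \<and> word_value p es = x)"

definition idempotent_width :: "('b \<Rightarrow> 'b \<Rightarrow> 'b) \<Rightarrow> enat"
  where "idempotent_width p = (SUP x\<in>idempotent_products p. enat (idempotent_length p x))"

definition quadratically_closed :: "'a::field itself \<Rightarrow> bool"
  where "quadratically_closed _ \<longleftrightarrow> (\<forall>q::'a poly. degree q = 2 \<longrightarrow> (\<exists>x. poly q x = 0))"

end

theory Submission
  imports Defs
begin

text \<open>
  The length of a nonscalar matrix depends only on its trace and determinant, because one more
  factor acts on these two numbers by an explicit rule.  In \<open>2 \<times> 2\<close> matrices the idempotents other
  than \<open>0\<close> and \<open>1\<close> are those of trace \<open>1\<close> and determinant \<open>0\<close>.  Let \<open>e\<close> be one of them and let \<open>X\<close> have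
  trace \<open>t\<close> and determinant \<open>d\<close>.  In a basis adapted to \<open>e\<close>, multiplication by \<open>e\<close> keeps one diagonal
  entry of \<open>X\<close>, deletes the other and halves the off-diagonal ones; hence the trace \<open>\<tau>\<close> and the
  determinant \<open>\<delta>\<close> of the product satisfy \<open>4\<delta> = d - \<tau>t + \<tau>\<^sup>2\<close> (\<open>det_jordan_mult_rank_one\<close>).
  Conversely, whenever a nonscalar \<open>A\<close> satisfies this relation with some \<open>(t, d)\<close>, it equals
  \<open>B \<circ> e\<close> for a nonscalar \<open>B\<close> with invariants \<open>(t, d)\<close> (\<open>ex_jordan_factor\<close>).  As scalar intermediate
  values of a word can only be \<open>0\<close> or \<open>1\<close>, a nonscalar \<open>A\<close> is the value of a word of length
  \<open>m + 1\<close> exactly when \<open>(\<tau>, \<delta>)\<close> is reached from \<open>(1, 0)\<close> in \<open>m\<close> steps of the relation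
  (\<open>ex_word_iff\<close>).

  It remains to solve the recursion.  One step gives \<open>4\<delta> = \<tau>(\<tau> - 1)\<close>.  Two steps ask for a root \<open>t\<close> of
  a quadratic polynomial whose discriminant is \<open>\<eta> = 1 + 8\<tau> + 64\<delta>\<close>.  Three steps ask for a \<open>t\<close> for
  which the \<open>\<eta>\<close> of the predecessor is a square; this \<open>\<eta>\<close> is affine in \<open>t\<close> with slope \<open>8(1 + 8\<tau>)\<close>,
  so it can be made \<open>0\<close> unless \<open>\<tau> = -1/8\<close>, in which case it is the constant \<open>4\<eta>\<close>.  Four steps reach
  everything, through a predecessor of trace \<open>0\<close>.
\<close>

section \<open>Matrices of size two\<close>

\<comment> \<open>otherwise \<open>$\<close> is ambiguous between matrix entries and coefficients of power series\<close>
unbundle no fps_syntax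

definition mat22 :: "'a \<Rightarrow> 'a \<Rightarrow> 'a \<Rightarrow> 'a \<Rightarrow> 'a::zero^2^2"
  where "mat22 a b c d = vector [vector [a, b], vector [c, d]]"

lemma mat22_nth [simp]:
  "mat22 a b c d $ 1 $ 1 = a" "mat22 a b c d $ 1 $ 2 = b"
  "mat22 a b c d $ 2 $ 1 = c" "mat22 a b c d $ 2 $ 2 = d"
  by (simp_all add: mat22_def)

lemma mat22_cases:
  obtains a b c d where "A = mat22 a b c d"
proof
  show "A = mat22 (A$1$1) (A$1$2) (A$2$1) (A$2$2)"
    by (simp add: vec_eq_iff forall_2)
qed

lemma mat22_eq_iff [simp]:
  "mat22 a b c d = mat22 a' b' c' d' \<longleftrightarrow> a = a' \<and> b = b' \<and> c = c' \<and> d = d'"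
  by (auto simp: vec_eq_iff forall_2)

lemma mat_eq_mat22: "mat c = mat22 c 0 0 c"
  by (simp add: vec_eq_iff forall_2 mat_def)

lemma zero_eq_mat22: "0 = mat22 0 0 0 (0::'a::zero)"
  by (simp add: vec_eq_iff forall_2)

lemma mat22_mult:
  "mat22 a b c d ** mat22 a' b' c' d' =
     mat22 (a*a' + b*c') (a*b' + b*d') (c*a' + d*c') (c*b' + d*d' :: 'a::field)"
  by (simp add: vec_eq_iff forall_2 matrix_matrix_mult_def sum_2)

lemma trace_mat22: "trace (mat22 a b c d) = a + d"
  by (simp add: trace_def sum_2)

lemma det_mat22: "det (mat22 a b c d) = a*d - b*c"
  by (simp add: det_2)

lemma jordan_mult_mat22:
  "mat22 a b c d \<circ>\<^sub>J mat22 a' b' c' d' =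
     mat22 ((a*a' + b*c' + (a'*a + b'*c)) / 2) ((a*b' + b*d' + (a'*b + b'*d)) / 2)
           ((c*a' + d*c' + (c'*a + d'*c)) / 2) ((c*b' + d*d' + (c'*b + d'*d)) / 2)"
  by (simp add: vec_eq_iff forall_2 jordan_mult_def mat22_mult)

definition scalar :: "'a::zero^2^2 \<Rightarrow> bool"
  where "scalar A \<longleftrightarrow> (\<exists>c. A = mat c)"

lemma scalar_mat22: "scalar (mat22 a b c d) \<longleftrightarrow> b = 0 \<and> c = 0 \<and> a = d"
  by (auto simp: scalar_def mat_eq_mat22)

section \<open>Idempotents\<close>

lemma idempotent_elem_iff:
  assumes "(2::'a::field) \<noteq> 0"
  shows "idempotent_elem (\<circ>\<^sub>J) (e :: 'a^2^2) \<longleftrightarrow> e ** e = e"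
proof -
  have "(1/2) * (x + x) = x" for x :: 'a
    using assms by (simp flip: mult_2)
  then have "e \<circ>\<^sub>J e = e ** e"
    by (simp add: jordan_mult_def vec_eq_iff)
  then show ?thesis by (simp add: idempotent_elem_def)
qed

text \<open>
  If \<open>e\<close> has an off-diagonal entry, comparing that entry in \<open>e\<^sup>2 = e\<close> forces the trace to be \<open>1\<close>;
  conversely, a matrix of trace \<open>1\<close> and determinant \<open>0\<close> is idempotent by Cayley-Hamilton.
\<close>

lemma idempotent_trichotomy:
  fixes e :: "'a::field^2^2"
  shows "e ** e = e \<longleftrightarrow> e = 0 \<or> e = mat 1 \<or> trace e = 1 \<and> det e = 0"
proof -
  obtain a b c d where e: "e = mat22 a b c d" by (rule mat22_cases)
  have "e ** e = e" if "trace e = 1" "det e = 0"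
  proof -
    have "d = 1 - a" using that(1) by (simp add: e trace_mat22 algebra_simps)
    moreover have "a*a + b*c = a" using that(2) calculation by (simp add: e det_mat22) algebra
    ultimately show ?thesis
      unfolding e mat22_mult mat22_eq_iff by algebra
  qed
  moreover have "e = 0 \<or> e = mat 1 \<or> trace e = 1 \<and> det e = 0" if "e ** e = e"
  proof -
    have eqs: "a*a + b*c = a" "a*b + b*d = b" "c*a + d*c = c" "c*b + d*d = d"
      using that by (simp_all add: e mat22_mult)
    show ?thesis
    proof (cases "b = 0 \<and> c = 0")
      case True
      then show ?thesis using eqs by (auto simp: e zero_eq_mat22 mat_eq_mat22 trace_mat22 det_mat22)
    next
      case False
      have "b * (a + d - 1) = 0" using eqs(2) by (simp add: algebra_simps)
      moreover have "c * (a + d - 1) = 0" using eqs(3) by (simp add: algebra_simps)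
      ultimately have "a + d - 1 = 0" using False by auto
      then have "a + d = 1" "a * d - b * c = 0" using eqs(1) by algebra+
      then show ?thesis by (simp add: e trace_mat22 det_mat22)
    qed
  qed
  ultimately show ?thesis
    by (auto simp: e zero_eq_mat22 mat_eq_mat22 mat22_mult)
qed

lemma rank_one_cases:
  fixes e :: "'a::field^2^2"
  assumes "trace e = 1" "det e = 0"
  obtains a b c where "e = mat22 a b c (1 - a)" "b * c = a * (1 - a)"
proof -
  obtain a b c d where e: "e = mat22 a b c d" by (rule mat22_cases)
  have "a + d = 1" "a * d - b * c = 0" using assms by (simp_all add: e trace_mat22 det_mat22)
  then have "d = 1 - a" "b * c = a * (1 - a)" by algebra+
  then show thesis using that e by blast
qed

lemma nonscalar_rank_one:
  fixes e :: "'a::field^2^2"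
  assumes "trace e = 1" "det e = 0"
  shows "\<not> scalar e"
proof -
  obtain a b c where e: "e = mat22 a b c (1 - a)" and bc: "b * c = a * (1 - a)"
    using rank_one_cases[OF assms] .
  have "a \<noteq> 1 - a" if "b = 0"
  proof
    assume "a = 1 - a"
    with bc that have "a = 0" by simp
    with \<open>a = 1 - a\<close> show False by simp
  qed
  then show ?thesis by (auto simp: e scalar_mat22)
qed

lemma jordan_mult_eq_iff:
  assumes "(2::'a::field) \<noteq> 0"
  shows "mat22 x1 x2 x3 x4 \<circ>\<^sub>J mat22 a b c d = mat22 y1 y2 y3 (y4 :: 'a) \<longleftrightarrow>
    2 * y1 = 2 * x1 * a + x2 * c + x3 * b \<and> 2 * y2 = x2 * (a + d) + (x1 + x4) * b \<and>
    2 * y3 = x3 * (a + d) + (x1 + x4) * c \<and> 2 * y4 = 2 * x4 * d + x2 * c + x3 * b"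
proof -
  have half: "x / 2 = y \<longleftrightarrow> 2 * y = x" for x y :: 'a
    using assms by (auto simp: field_simps)
  show ?thesis
    unfolding jordan_mult_mat22 mat22_eq_iff half by (simp add: algebra_simps)
qed

section \<open>Multiplication by a rank-one idempotent\<close>

text \<open>
  Both sides are similarity invariant, and for \<open>e = diag(1, 0)\<close> and \<open>X\<close> with rows \<open>(p, q)\<close>, \<open>(r, s)\<close>
  the product has rows \<open>(p, q/2)\<close>, \<open>(r/2, 0)\<close>: the claim becomes \<open>-qr = (ps - qr) - p(p + s) + p\<^sup>2\<close>.
  The proof avoids the change of basis, since the identity in entries follows from \<open>bc = a(1 - a)\<close>.
\<close>

lemma det_jordan_mult_rank_one:
  fixes X e :: "'a::field^2^2"
  assumes two: "(2::'a) \<noteq> 0" and e: "trace e = 1" "det e = 0"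
  defines "t \<equiv> trace (X \<circ>\<^sub>J e)"
  shows "4 * det (X \<circ>\<^sub>J e) = det X - t * trace X + t^2"
proof -
  obtain a b c where e: "e = mat22 a b c (1 - a)" and bc: "b * c = a * (1 - a)"
    using rank_one_cases[OF e] .
  obtain x1 x2 x3 x4 where X: "X = mat22 x1 x2 x3 x4" by (rule mat22_cases)
  obtain y1 y2 y3 y4 where Y: "X \<circ>\<^sub>J e = mat22 y1 y2 y3 y4" by (rule mat22_cases)
  have ys: "2 * y1 = 2 * x1 * a + x2 * c + x3 * b" "2 * y2 = x2 + (x1 + x4) * b"
    "2 * y3 = x3 + (x1 + x4) * c" "2 * y4 = 2 * x4 * (1 - a) + x2 * c + x3 * b"
    using Y jordan_mult_eq_iff[OF two] by (simp_all add: X e)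
  \<comment> \<open>The entries of the product are known only up to the factor \<open>2\<close>, so the identity is first
      obtained multiplied by \<open>4\<close>.\<close>
  have "4 * (4 * (y1 * y4 - y2 * y3)) =
      4 * (x1 * x4 - x2 * x3 - (y1 + y4) * (x1 + x4) + (y1 + y4)^2)"
    using ys bc by algebra
  moreover have "(4::'a) = 2 * 2" by simp
  ultimately have "4 * (y1 * y4 - y2 * y3) =
      x1 * x4 - x2 * x3 - (y1 + y4) * (x1 + x4) + (y1 + y4)^2"
    using two by (metis mult_left_cancel no_zero_divisors)
  then show ?thesis unfolding t_def Y unfolding X det_mat22 trace_mat22 .
qed

text \<open>
  The block of \<open>X \<circ> e\<close> on the kernel of \<open>e\<close> vanishes, so a scalar value must be \<open>0\<close>.
\<close>

lemma scalar_jordan_mult_rank_one: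
  fixes X e :: "'a::field^2^2"
  assumes two: "(2::'a) \<noteq> 0" and e: "trace e = 1" "det e = 0" and "scalar (X \<circ>\<^sub>J e)"
  shows "X \<circ>\<^sub>J e = 0"
proof -
  obtain a b c where e: "e = mat22 a b c (1 - a)" and bc: "b * c = a * (1 - a)"
    using rank_one_cases[OF e] .
  obtain x1 x2 x3 x4 where X: "X = mat22 x1 x2 x3 x4" by (rule mat22_cases)
  obtain y where Y: "X \<circ>\<^sub>J e = mat22 y 0 0 y"
    using assms(4) by (auto simp: scalar_def mat_eq_mat22)
  have "2 * y = 2 * x1 * a + x2 * c + x3 * b" "2 * 0 = x2 * (a + (1 - a)) + (x1 + x4) * b"
    "2 * 0 = x3 * (a + (1 - a)) + (x1 + x4) * c" "2 * y = 2 * x4 * (1 - a) + x2 * c + x3 * b"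
    using Y unfolding X e jordan_mult_eq_iff[OF two] by blast+
  then have ys: "x2 = - ((x1 + x4) * b)" "x3 = - ((x1 + x4) * c)"
    "2 * y = 2 * x1 * a + x2 * c + x3 * b" "2 * y = 2 * x4 * (1 - a) + x2 * c + x3 * b"
    by (simp_all add: eq_neg_iff_add_eq_0)
  \<comment> \<open>As the off-diagonal entries of \<open>X \<circ> e\<close> vanish, the diagonal ones of \<open>2(X \<circ> e)\<close> are \<open>2ak\<close> and
      \<open>-2(1 - a)k\<close>; both are \<open>2y\<close>, and weighting them by \<open>1 - a\<close> and \<open>a\<close> makes them cancel.\<close>
  define k where "k = a * x1 - (1 - a) * x4"
  have "2 * y = 2 * a * k" "2 * y = - 2 * (1 - a) * k"
    using ys bc k_def by algebra+
  then have "2 * y = (1 - a) * (2 * a * k) + a * (- 2 * (1 - a) * k)" by algebra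
  also have "\<dots> = 0" by (simp add: algebra_simps)
  finally have "2 * y = 0" .
  then show ?thesis using two by (simp add: Y zero_eq_mat22)
qed

text \<open>
  Take \<open>f = uv\<^sup>T\<close> with \<open>v\<^sup>Tu = 1\<close> and \<open>v\<^sup>TAu = 0\<close>, where \<open>u\<close> is not an eigenvector of \<open>A\<close>: such a \<open>u\<close>
  exists for nonscalar \<open>A\<close>, and then \<open>v\<close> may be prescribed on the independent vectors \<open>u\<close>, \<open>Au\<close>.
  The three cases choose \<open>u\<close> as the first basis vector, the second one, and their sum.
\<close>

lemma ex_rank_one_traceless:
  fixes A :: "'a::field^2^2"
  assumes "\<not> scalar A"
  shows "\<exists>f. trace f = 1 \<and> det f = 0 \<and> trace (A ** f) = 0 \<and> A ** f \<noteq> 0"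
proof -
  obtain p q r w where A: "A = mat22 p q r w" by (rule mat22_cases)
  note simps = A trace_mat22 det_mat22 mat22_mult zero_eq_mat22
  from assms consider "r \<noteq> 0" | "q \<noteq> 0" | "q = 0" "r = 0" "p \<noteq> w"
    by (auto simp: A scalar_mat22)
  then show ?thesis
  proof cases
    case 1
    then show ?thesis by (intro exI[of _ "mat22 1 (-p/r) 0 0"]) (simp add: simps)
  next
    case 2
    then show ?thesis by (intro exI[of _ "mat22 0 0 (-w/q) 1"]) (simp add: simps)
  next
    case 3
    define k where "k = inverse (p - w)"
    have k: "k * (p - w) = 1" using 3 by (simp add: k_def)
    have "k * p - k * w = 1" "- (k * w) * (k * p) - k * p * (- (k * w)) = 0"
      "p * (- (k * w)) + w * (k * p) = 0" using k by algebra+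
    moreover have "p * (- (k * w)) \<noteq> 0 \<or> p * (k * p) \<noteq> 0 \<or> w * (k * w) \<noteq> 0"
      using 3 k by auto
    ultimately show ?thesis using 3
      by (intro exI[of _ "mat22 (- (k * w)) (k * p) (- (k * w)) (k * p)"])
         (auto simp: simps algebra_simps)
  qed
qed

text \<open>
  Let \<open>f\<close> be the idempotent just found and \<open>e = 1 - f\<close>.  Since \<open>fAf = 0\<close> and \<open>eAe = \<tau>e\<close>, the matrix
  \<open>2A - \<tau>e\<close> has the right product with \<open>e\<close>, and adding a multiple of \<open>f\<close> does not change this product.
  The multiple \<open>t - \<tau>\<close> gives \<open>B\<close> the trace \<open>t\<close>, and the assumed relation then says \<open>det B = d\<close>.
  If \<open>B\<close> were scalar, \<open>Af\<close> would be a multiple of \<open>f\<close> of trace \<open>0\<close>, hence zero.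
\<close>

lemma ex_jordan_factor:
  fixes A :: "'a::field^2^2"
  assumes two: "(2::'a) \<noteq> 0" and A: "\<not> scalar A"
    and td: "4 * det A = d - trace A * t + (trace A)^2"
  shows "\<exists>B e. \<not> scalar B \<and> trace B = t \<and> det B = d \<and> trace e = 1 \<and> det e = 0 \<and> B \<circ>\<^sub>J e = A"
proof -
  obtain f where f: "trace f = 1" "det f = 0" and Af: "trace (A ** f) = 0" "A ** f \<noteq> 0"
    using ex_rank_one_traceless[OF A] by blast
  obtain a b c where f: "f = mat22 a b c (1 - a)" and bc: "b * c = a * (1 - a)"
    using rank_one_cases[OF f] .
  obtain p q r w where A: "A = mat22 p q r w" by (rule mat22_cases)
  define \<tau> where "\<tau> = p + w"
  define e where "e = mat22 (1 - a) (-b) (-c) a"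
  \<comment> \<open>\<open>B = 2A - \<tau>e + (t - \<tau>)f\<close>\<close>
  define B where "B = mat22 (2*p - \<tau> * (1 - a) + (t - \<tau>) * a) (2*q + t * b)
    (2*r + t * c) (2*w - \<tau> * a + (t - \<tau>) * (1 - a))"
  have tr: "p * a + q * c + (r * b + w * (1 - a)) = 0"
    using Af(1) by (simp add: A f mat22_mult trace_mat22)
  have td: "4 * (p * w - q * r) = d - \<tau> * t + \<tau>^2"
    using td by (simp add: A det_mat22 trace_mat22 \<tau>_def)
  have "trace e = 1" "det e = 0"
    using bc by (simp_all add: e_def trace_mat22 det_mat22)
  moreover have "trace B = t"
    by (simp add: B_def trace_mat22 \<tau>_def algebra_simps)
  moreover have "det B = d"
    unfolding B_def det_mat22 using tr bc td \<tau>_def by algebra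
  moreover have "B \<circ>\<^sub>J e = A"
    unfolding B_def e_def A jordan_mult_eq_iff[OF two] using tr bc \<tau>_def
    by (intro conjI; algebra)
  moreover have "\<not> scalar B"
  proof
    assume "scalar B"
    then have "2*q + t * b = 0" "2*r + t * c = 0"
      "2*p - \<tau> * (1 - a) + (t - \<tau>) * a = 2*w - \<tau> * a + (t - \<tau>) * (1 - a)"
      by (simp_all add: B_def scalar_mat22)
    then have "2 * w = t * a" "2 * p = t * (1 - a)" "2 * q = - (t * b)" "2 * r = - (t * c)"
      using tr bc \<tau>_def by algebra+
    then have "2 * (p * a + q * c) = 0" "2 * (p * b + q * (1 - a)) = 0"
      "2 * (r * a + w * c) = 0" "2 * (r * b + w * (1 - a)) = 0"
      using bc unfolding distrib_left mult.assoc[symmetric] by algebra+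
    then have "A ** f = 0"
      using two unfolding A f mat22_mult zero_eq_mat22 mat22_eq_iff mult_eq_0_iff by blast
    with Af(2) show False by simp
  qed
  ultimately show ?thesis by blast
qed


section \<open>The recursion on trace and determinant\<close>

text \<open>
  The pairs (trace, determinant) reached from those of a rank-one idempotent by \<open>m\<close> further factors.
\<close>

fun word_invariants :: "nat \<Rightarrow> 'a::field \<Rightarrow> 'a \<Rightarrow> bool"
  where
    "word_invariants 0 \<tau> \<delta> \<longleftrightarrow> \<tau> = 1 \<and> \<delta> = 0"
  | "word_invariants (Suc m) \<tau> \<delta> \<longleftrightarrow>
       (\<exists>t d. word_invariants m t d \<and> 4 * \<delta> = d - \<tau> * t + \<tau>^2)"

text \<open>
  The pair \<open>(1, 0)\<close> steps to itself, as \<open>e \<circ> e = e\<close>; this propagates through the recursion.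
\<close>

lemma word_invariants_Suc:
  "word_invariants m \<tau> \<delta> \<Longrightarrow> word_invariants (Suc m) \<tau> (\<delta> :: 'a::field)"
proof (induction m arbitrary: \<tau> \<delta>)
  case 0
  then show ?case by (simp add: power2_eq_square)
next
  case (Suc m)
  then show ?case by (metis word_invariants.simps(2))
qed

lemma word_invariants_mono:
  "m \<le> n \<Longrightarrow> word_invariants m \<tau> \<delta> \<Longrightarrow> word_invariants n \<tau> (\<delta> :: 'a::field)"
  by (induction n rule: dec_induct) (auto dest: word_invariants_Suc simp del: word_invariants.simps)

lemma word_invariants_1: "word_invariants (Suc 0) \<tau> \<delta> \<longleftrightarrow> 4 * \<delta> = \<tau> * (\<tau> - (1::'a::field))"
  by (simp add: power2_eq_square algebra_simps)

lemma four_eight_neq_0: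
  assumes "(2::'a::field) \<noteq> 0"
  shows "(4::'a) \<noteq> 0" "(8::'a) \<noteq> 0"
proof -
  have "(4::'a) = 2 * 2" "(8::'a) = 2 * 2 * 2" by simp_all
  then show "(4::'a) \<noteq> 0" "(8::'a) \<noteq> 0" using assms by (metis no_zero_divisors)+
qed

lemma is_square_iff: "is_square (x::'a::field) \<longleftrightarrow> (\<exists>y. x = y^2)"
  by (auto simp: is_nth_power_def)

lemma is_square_4_mult:
  assumes "(2::'a::field) \<noteq> 0"
  shows "is_square (4 * x :: 'a) \<longleftrightarrow> is_square x"
proof
  assume "is_square (4 * x)"
  then obtain y where "4 * x = y^2" by (auto simp: is_square_iff)
  then have "x = (y / 2)^2" using assms four_eight_neq_0[OF assms]
    by (simp add: power2_eq_square field_simps)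
  then show "is_square x" unfolding is_square_iff by blast
next
  assume "is_square x"
  then obtain y where "x = y^2" by (auto simp: is_square_iff)
  then have "4 * x = (2 * y)^2" by (simp add: power2_eq_square)
  then show "is_square (4 * x)" unfolding is_square_iff by blast
qed

text \<open>
  Eliminating the determinant of the predecessor leaves a quadratic equation in its trace \<open>t\<close>, and
  \<open>2t - 1 - 4\<tau>\<close> is the quantity that completes the square.
\<close>

lemma word_invariants_2:
  assumes two: "(2::'a::field) \<noteq> 0"
  shows "word_invariants (Suc (Suc 0)) \<tau> \<delta> \<longleftrightarrow> is_square (1 + 8 * \<tau> + 64 * \<delta> :: 'a)"
proof -
  have eq: "4 * d = t * (t - 1) \<and> 4 * \<delta> = d - \<tau> * t + \<tau>^2 \<longleftrightarrow>
    d = 4 * \<delta> + \<tau> * t - \<tau>^2 \<and> 1 + 8 * \<tau> + 64 * \<delta> = (2 * t - 1 - 4 * \<tau>)^2" for t d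
  proof -
    have "4 * d = t * (t - 1)" if "d = 4 * \<delta> + \<tau> * t - \<tau>^2"
      "1 + 8 * \<tau> + 64 * \<delta> = (2 * t - 1 - 4 * \<tau>)^2"
    proof -
      have "4 * (4 * d) = 4 * (t * (t - 1))" using that by algebra
      then show ?thesis using four_eight_neq_0[OF two] by (metis mult_left_cancel)
    qed
    moreover have "1 + 8 * \<tau> + 64 * \<delta> = (2 * t - 1 - 4 * \<tau>)^2" "d = 4 * \<delta> + \<tau> * t - \<tau>^2"
      if "4 * d = t * (t - 1)" "4 * \<delta> = d - \<tau> * t + \<tau>^2"
      using that by algebra+
    moreover have "4 * \<delta> = d - \<tau> * t + \<tau>^2" if "d = 4 * \<delta> + \<tau> * t - \<tau>^2"
      using that by algebra
    ultimately show ?thesis by blast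
  qed
  have "word_invariants (Suc (Suc 0)) \<tau> \<delta> \<longleftrightarrow>
      (\<exists>t. 1 + 8 * \<tau> + 64 * \<delta> = (2 * t - 1 - 4 * \<tau>)^2)"
    unfolding word_invariants.simps(2)[of "Suc 0"] word_invariants_1 eq by blast
  also have "\<dots> \<longleftrightarrow> (\<exists>y. 1 + 8 * \<tau> + 64 * \<delta> = y^2)"
  proof (intro iffI; elim exE)
    fix t assume "1 + 8 * \<tau> + 64 * \<delta> = (2 * t - 1 - 4 * \<tau>)^2"
    then show "\<exists>y. 1 + 8 * \<tau> + 64 * \<delta> = y^2" by blast
  next
    fix y assume "1 + 8 * \<tau> + 64 * \<delta> = y^2"
    moreover define t where "t = (y + 1 + 4 * \<tau>) / 2"
    then have "2 * t = y + 1 + 4 * \<tau>"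
      using two by (metis nonzero_mult_div_cancel_left times_divide_eq_right)
    ultimately have "1 + 8 * \<tau> + 64 * \<delta> = (2 * t - 1 - 4 * \<tau>)^2" by simp
    then show "\<exists>t. 1 + 8 * \<tau> + 64 * \<delta> = (2 * t - 1 - 4 * \<tau>)^2" by blast
  qed
  finally show ?thesis by (simp add: is_square_iff)
qed

text \<open>
  The predecessor \<open>(t, 4\<delta> + \<tau>t - \<tau>\<^sup>2)\<close> has discriminant \<open>8(1 + 8\<tau>)t + 1 + 256\<delta> - 64\<tau>\<^sup>2\<close>.
\<close>

lemma word_invariants_3:
  assumes two: "(2::'a::field) \<noteq> 0"
  shows "word_invariants (Suc (Suc (Suc 0))) \<tau> \<delta> \<longleftrightarrow>
    is_square (1 + 8 * \<tau> + 64 * \<delta>) \<or> \<tau> \<noteq> - 1 / (8::'a)"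
proof -
  note nz = four_eight_neq_0[OF two]
  have "4 * \<delta> = d - \<tau> * t + \<tau>^2 \<longleftrightarrow> d = 4 * \<delta> + \<tau> * t - \<tau>^2" for t d
    by (auto simp: algebra_simps)
  then have *: "word_invariants (Suc (Suc (Suc 0))) \<tau> \<delta> \<longleftrightarrow>
      (\<exists>t. is_square (1 + 8 * t + 64 * (4 * \<delta> + \<tau> * t - \<tau>^2)))"
    unfolding word_invariants.simps(2)[of "Suc (Suc 0)"] word_invariants_2[OF two] by auto
  show ?thesis
  proof (cases "\<tau> = - 1 / 8")
    case True
    then have \<tau>: "8 * \<tau> = -1" using nz by simp
    have "1 + 8 * t + 64 * (4 * \<delta> + \<tau> * t - \<tau>^2) = 4 * (1 + 8 * \<tau> + 64 * \<delta>)" for t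
      using \<tau> by algebra
    then have "word_invariants (Suc (Suc (Suc 0))) \<tau> \<delta> \<longleftrightarrow> is_square (4 * (1 + 8 * \<tau> + 64 * \<delta>))"
      unfolding * by (simp only: simp_thms)
    with True show ?thesis unfolding is_square_4_mult[OF two] by blast
  next
    case False
    then have "1 + 8 * \<tau> \<noteq> 0" using nz by (auto simp: field_simps add_eq_0_iff)
    then have k: "8 * (1 + 8 * \<tau>) \<noteq> 0" using nz unfolding mult_eq_0_iff by blast
    \<comment> \<open>the zero of the discriminant of the predecessor\<close>
    define t where "t = (64 * \<tau>^2 - 256 * \<delta> - 1) / (8 * (1 + 8 * \<tau>))"
    have "8 * (1 + 8 * \<tau>) * t = 64 * \<tau>^2 - 256 * \<delta> - 1"
      unfolding t_def by (rule nonzero_mult_div_cancel_left[OF k, folded times_divide_eq_right])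
    then have "1 + 8 * t + 64 * (4 * \<delta> + \<tau> * t - \<tau>^2) = 0^2"
      by (simp add: algebra_simps eq_diff_eq flip: distrib_left)
    with False show ?thesis unfolding * is_square_iff by blast
  qed
qed

lemma word_invariants_4:
  assumes two: "(2::'a::field) \<noteq> 0"
  shows "word_invariants (Suc (Suc (Suc (Suc 0)))) \<tau> (\<delta>::'a)"
proof -
  \<comment> \<open>The predecessor of trace \<open>0\<close> avoids the exceptional value \<open>-1/8\<close>.\<close>
  have "word_invariants (Suc (Suc (Suc 0))) 0 (4 * \<delta> - \<tau>^2)"
    unfolding word_invariants_3[OF two] using four_eight_neq_0[OF two] by simp
  then show ?thesis unfolding word_invariants.simps(2)[of "Suc (Suc (Suc 0))"]
    by (intro exI conjI) (assumption, simp)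
qed

section \<open>Lengths of words\<close>

lemma jordan_mult_zero_one:
  assumes "(2::'a::field) \<noteq> 0"
  shows "X \<circ>\<^sub>J 0 = 0" "0 \<circ>\<^sub>J X = 0" "X \<circ>\<^sub>J mat 1 = X" "mat 1 \<circ>\<^sub>J X = (X :: 'a^2^2)"
  using jordan_mult_eq_iff[OF assms]
  by (cases X rule: mat22_cases; simp add: zero_eq_mat22 mat_eq_mat22)+

lemma word_value_snoc: "es \<noteq> [] \<Longrightarrow> word_value p (es @ [e]) = p (word_value p es) e"
  by (cases es) auto

lemma is_idempotent_word_snoc:
  "es \<noteq> [] \<Longrightarrow> is_idempotent_word p (es @ [e]) \<longleftrightarrow> is_idempotent_word p es \<and> idempotent_elem p e"
  by (auto simp: is_idempotent_word_def)

lemma idempotent_elem_cases: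
  assumes "(2::'a::field) \<noteq> 0"
  shows "idempotent_elem (\<circ>\<^sub>J) (e :: 'a^2^2) \<longleftrightarrow> e = 0 \<or> e = mat 1 \<or> trace e = 1 \<and> det e = 0"
  by (simp add: idempotent_elem_iff[OF assms] idempotent_trichotomy)

text \<open>
  The recursion describes the nonscalar values.  The scalars \<open>0\<close> and \<open>1\<close> are kept apart: multiplying \<open>1\<close> by \<open>e\<close> starts afresh from \<open>(1, 0)\<close>, and \<open>0\<close> is never left.  A factor \<open>1\<close> wastes
  a letter, which monotonicity of the recursion absorbs.
\<close>

lemma word_value_invariants:
  fixes es :: "('a::field^2^2) list"
  assumes two: "(2::'a) \<noteq> 0"
  assumes "is_idempotent_word (\<circ>\<^sub>J) es"
  shows "word_value (\<circ>\<^sub>J) es \<in> {0, mat 1} \<or> \<not> scalar (word_value (\<circ>\<^sub>J) es) \<and>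
    word_invariants (length es - 1) (trace (word_value (\<circ>\<^sub>J) es)) (det (word_value (\<circ>\<^sub>J) es))"
  using assms(2)
proof (induction es rule: rev_induct)
  case Nil
  then show ?case by (simp add: is_idempotent_word_def)
next
  case (snoc e es)
  show ?case
  proof (cases "es = []")
    case True
    then show ?thesis using snoc.prems nonscalar_rank_one[of e]
      by (auto simp: is_idempotent_word_def idempotent_elem_cases[OF two])
  next
    case False
    define X where "X = word_value (\<circ>\<^sub>J) es"
    define m where "m = length es - 1"
    have len: "length (es @ [e]) - 1 = Suc m" using False by (simp add: m_def)
    have val: "word_value (\<circ>\<^sub>J) (es @ [e]) = X \<circ>\<^sub>J e"
      using False by (simp add: word_value_snoc X_def)
    have IH: "X = 0 \<or> X = mat 1 \<or> \<not> scalar X \<and> word_invariants m (trace X) (det X)"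
      and "idempotent_elem (\<circ>\<^sub>J) e"
      using snoc False by (auto simp: is_idempotent_word_snoc X_def m_def)
    then consider "e = 0" | "e = mat 1" | "trace e = 1" "det e = 0"
      by (auto simp: idempotent_elem_cases[OF two])
    then show ?thesis
    proof cases
      case 1
      then show ?thesis unfolding len val by (simp add: jordan_mult_zero_one[OF two])
    next
      case 2
      then show ?thesis unfolding len val using IH word_invariants_Suc
        by (auto simp: jordan_mult_zero_one[OF two] simp del: word_invariants.simps)
    next
      case e: 3
      from IH consider "X = 0" | "X = mat 1" | "word_invariants m (trace X) (det X)" by blast
      then show ?thesis
      proof cases
        case 1
        then show ?thesis unfolding len val by (simp add: jordan_mult_zero_one[OF two])
      next
        case 2
        moreover have "word_invariants (Suc m) 1 (0::'a)"
          using word_invariants_mono[of 0 "Suc m"] by simp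
        ultimately show ?thesis unfolding len val using nonscalar_rank_one[OF e] e
          by (simp add: jordan_mult_zero_one[OF two] del: word_invariants.simps)
      next
        case 3
        then have "word_invariants (Suc m) (trace (X \<circ>\<^sub>J e)) (det (X \<circ>\<^sub>J e))"
          using det_jordan_mult_rank_one[OF two e, of X] unfolding word_invariants.simps by blast
        then show ?thesis unfolding len val using scalar_jordan_mult_rank_one[OF two e, of X] by blast
      qed
    qed
  qed
qed

lemma ex_word_if_invariants:
  fixes A :: "'a::field^2^2"
  assumes two: "(2::'a) \<noteq> 0" and "\<not> scalar A" "word_invariants m (trace A) (det A)"
  shows "\<exists>es. is_idempotent_word (\<circ>\<^sub>J) es \<and> length es = Suc m \<and> word_value (\<circ>\<^sub>J) es = A"
  using assms(2,3)
proof (induction m arbitrary: A)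
  case 0
  then have "is_idempotent_word (\<circ>\<^sub>J) [A]"
    by (simp add: is_idempotent_word_def idempotent_elem_cases[OF two])
  then show ?case by (intro exI[of _ "[A]"]) simp
next
  case (Suc m)
  then obtain t d where td: "word_invariants m t d" "4 * det A = d - trace A * t + (trace A)^2"
    by auto
  obtain B e where B: "\<not> scalar B" "trace B = t" "det B = d"
    and e: "trace e = 1" "det e = 0" and BeA: "B \<circ>\<^sub>J e = A"
    using ex_jordan_factor[OF two Suc.prems(1) td(2)] by blast
  obtain es where es: "is_idempotent_word (\<circ>\<^sub>J) es" "length es = Suc m" "word_value (\<circ>\<^sub>J) es = B"
    using Suc.IH[OF B(1)] B td(1) by blast
  then have "es \<noteq> []" by auto
  with es e BeA show ?case
    by (intro exI[of _ "es @ [e]"])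
       (auto simp: is_idempotent_word_snoc word_value_snoc idempotent_elem_cases[OF two])
qed

lemma ex_word_iff:
  fixes A :: "'a::field^2^2"
  assumes two: "(2::'a) \<noteq> 0" and A: "\<not> scalar A"
  shows "(\<exists>es. is_idempotent_word (\<circ>\<^sub>J) es \<and> length es = n \<and> word_value (\<circ>\<^sub>J) es = A) \<longleftrightarrow>
    (\<exists>m. n = Suc m \<and> word_invariants m (trace A) (det A))" (is "?L \<longleftrightarrow> ?R")
proof
  assume ?L
  then obtain es where es: "is_idempotent_word (\<circ>\<^sub>J) es" "length es = n" "word_value (\<circ>\<^sub>J) es = A"
    by blast
  have "A \<noteq> 0" "A \<noteq> mat 1"
    using A by (auto simp: mat_eq_mat22 zero_eq_mat22 scalar_mat22)
  then have "word_invariants (n - 1) (trace A) (det A)"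
    using word_value_invariants[OF two es(1)] es by auto
  moreover have "n \<noteq> 0" using es by (auto simp: is_idempotent_word_def)
  ultimately show ?R by (intro exI[of _ "n - 1"]) auto
next
  assume ?R
  then show ?L using ex_word_if_invariants[OF two A] by auto
qed

lemma idempotent_length_eq:
  fixes A :: "'a::field^2^2"
  assumes two: "(2::'a) \<noteq> 0" and A: "\<not> scalar A"
    and "word_invariants m (trace A) (det A)"
    and "m \<noteq> 0 \<Longrightarrow> \<not> word_invariants (m - 1) (trace A) (det A)"
  shows "idempotent_length (\<circ>\<^sub>J) A = Suc m"
  unfolding idempotent_length_def ex_word_iff[OF two A]
proof (rule Least_equality)
  show "\<exists>k. Suc m = Suc k \<and> word_invariants k (trace A) (det A)" using assms(3) by blast
next
  fix n assume "\<exists>k. n = Suc k \<and> word_invariants k (trace A) (det A)"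
  then obtain k where k: "n = Suc k" "word_invariants k (trace A) (det A)" by blast
  have "\<not> k < m"
    using assms(4) word_invariants_mono[of k "m - 1" "trace A" "det A"] k(2) by force
  then show "Suc m \<le> n" using k(1) by simp
qed

lemma idempotent_length_one:
  assumes "idempotent_elem p e"
  shows "idempotent_length p e = 1"
  unfolding idempotent_length_def
proof (rule Least_equality)
  show "\<exists>es. is_idempotent_word p es \<and> length es = 1 \<and> word_value p es = e"
    using assms by (intro exI[of _ "[e]"]) (simp add: is_idempotent_word_def)
qed (auto simp: is_idempotent_word_def Suc_le_eq)

section \<open>Width\<close>

lemma quadratically_closed_iff:
  assumes two: "(2::'a::field) \<noteq> 0"
  shows "quadratically_closed TYPE('a) \<longleftrightarrow> (\<forall>x::'a. is_square x)"
proof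
  assume qc: "quadratically_closed TYPE('a)"
  show "\<forall>x::'a. is_square x"
  proof
    fix x :: 'a
    have "degree [:- x, 0, 1:] = 2" by simp
    then obtain y where "poly [:- x, 0, 1:] y = 0"
      using qc unfolding quadratically_closed_def by blast
    then have "x = y^2" by (simp add: power2_eq_square)
    then show "is_square x" unfolding is_square_iff by blast
  qed
next
  assume sq: "\<forall>x::'a. is_square x"
  show "quadratically_closed TYPE('a)"
    unfolding quadratically_closed_def
  proof (intro allI impI)
    fix q :: "'a poly" assume deg: "degree q = 2"
    define a b c where "a = coeff q 2" and "b = coeff q 1" and "c = coeff q 0"
    have a: "a \<noteq> 0" using deg unfolding a_def by (metis leading_coeff_0_iff degree_0 zero_neq_numeral)
    obtain s where s: "b^2 - 4 * a * c = s^2" using sq unfolding is_square_iff by blast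
    \<comment> \<open>quadratic formula\<close>
    define x where "x = (s - b) / (2 * a)"
    have "2 * a * x = s - b" using a two by (simp add: x_def)
    then have "4 * a * (a * x^2 + b * x + c) = 0 * a" using s by algebra
    then have "a * x^2 + b * x + c = 0" using a four_eight_neq_0[OF two] by simp
    moreover have "poly q x = a * x^2 + b * x + c"
      by (simp add: poly_altdef deg a_def b_def c_def numeral_2_eq_2 power2_eq_square algebra_simps)
    ultimately show "\<exists>x. poly q x = 0" by auto
  qed
qed

lemma idempotent_length_nonscalar:
  fixes A :: "'a::field^2^2"
  assumes two: "(2::'a) \<noteq> 0" and A: "\<not> scalar A"
  defines "\<tau> \<equiv> trace A" and "\<delta> \<equiv> det A"
  defines "\<eta> \<equiv> 1 + 8 * \<tau> + 64 * \<delta>"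
  shows "A ** A = A \<Longrightarrow> idempotent_length (\<circ>\<^sub>J) A = 1"
    and "A ** A \<noteq> A \<Longrightarrow> 4 * \<delta> = \<tau> * (\<tau> - 1) \<Longrightarrow> idempotent_length (\<circ>\<^sub>J) A = 2"
    and "4 * \<delta> \<noteq> \<tau> * (\<tau> - 1) \<Longrightarrow> is_square \<eta> \<Longrightarrow> idempotent_length (\<circ>\<^sub>J) A = 3"
    and "\<not> is_square \<eta> \<Longrightarrow> \<tau> \<noteq> - 1 / 8 \<Longrightarrow> idempotent_length (\<circ>\<^sub>J) A = 4"
    and "\<not> is_square \<eta> \<Longrightarrow> \<tau> = - 1 / 8 \<Longrightarrow> idempotent_length (\<circ>\<^sub>J) A = 5"
proof -
  note len = idempotent_length_eq[OF two A, folded \<tau>_def \<delta>_def]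
  note inv = word_invariants_1[of \<tau> \<delta>] word_invariants_2[OF two, of \<tau> \<delta>, folded \<eta>_def]
    word_invariants_3[OF two, of \<tau> \<delta>, folded \<eta>_def] word_invariants_4[OF two, of \<tau> \<delta>]
  have "A \<noteq> 0" "A \<noteq> mat 1"
    using A by (auto simp: mat_eq_mat22 zero_eq_mat22 scalar_mat22)
  then have idem: "A ** A = A \<longleftrightarrow> word_invariants 0 \<tau> \<delta>"
    by (simp add: idempotent_trichotomy \<tau>_def \<delta>_def)
  show "A ** A = A \<Longrightarrow> idempotent_length (\<circ>\<^sub>J) A = 1"
    using len[of 0] idem by simp
  show "A ** A \<noteq> A \<Longrightarrow> 4 * \<delta> = \<tau> * (\<tau> - 1) \<Longrightarrow> idempotent_length (\<circ>\<^sub>J) A = 2"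
    using len[of "Suc 0"] idem inv(1) by simp
  show "4 * \<delta> \<noteq> \<tau> * (\<tau> - 1) \<Longrightarrow> is_square \<eta> \<Longrightarrow> idempotent_length (\<circ>\<^sub>J) A = 3"
    using len[of "Suc (Suc 0)"] inv(1,2) by (simp del: word_invariants.simps)
  show "\<not> is_square \<eta> \<Longrightarrow> \<tau> \<noteq> - 1 / 8 \<Longrightarrow> idempotent_length (\<circ>\<^sub>J) A = 4"
    using len[of "Suc (Suc (Suc 0))"] inv(2,3) by (simp del: word_invariants.simps)
  show "\<not> is_square \<eta> \<Longrightarrow> \<tau> = - 1 / 8 \<Longrightarrow> idempotent_length (\<circ>\<^sub>J) A = 5"
    using len[of "Suc (Suc (Suc (Suc 0)))"] inv(3,4) by (simp del: word_invariants.simps)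
qed

lemma nonscalar_in_idempotent_products:
  fixes A :: "'a::field^2^2"
  assumes two: "(2::'a) \<noteq> 0" and A: "\<not> scalar A"
  shows "A \<in> idempotent_products (\<circ>\<^sub>J)"
  using ex_word_if_invariants[OF two A word_invariants_4[OF two]]
  unfolding idempotent_products_def by blast

lemma idempotent_length_scalar:
  fixes A :: "'a::field^2^2"
  assumes two: "(2::'a) \<noteq> 0" and "scalar A" "A \<in> idempotent_products (\<circ>\<^sub>J)"
  shows "idempotent_length (\<circ>\<^sub>J) A = 1"
proof -
  have "A = 0 \<or> A = mat 1"
    using assms(2,3) word_value_invariants[OF two] unfolding idempotent_products_def by auto
  then show ?thesis
    by (intro idempotent_length_one) (auto simp: idempotent_elem_cases[OF two])
qed

lemma idempotent_width_eqI:
  assumes "\<And>x. x \<in> idempotent_products p \<Longrightarrow> idempotent_length p x \<le> n"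
    and "x \<in> idempotent_products p" "idempotent_length p x = n"
  shows "idempotent_width p = enat n"
  unfolding idempotent_width_def
proof (rule antisym)
  show "(SUP x\<in>idempotent_products p. enat (idempotent_length p x)) \<le> enat n"
    using assms(1) by (intro SUP_least) auto
  show "enat n \<le> (SUP x\<in>idempotent_products p. enat (idempotent_length p x))"
    using assms(2,3) by (auto intro: SUP_upper2)
qed

theorem proposition4p1:
  assumes char_ne_2: "(2::'a::field) \<noteq> 0"
  shows "(\<forall>A :: 'a^2^2. (\<nexists>c. A = mat c) \<longrightarrow>
           (let \<tau> = trace A; \<delta> = det A; \<eta> = 1 + 8 * \<tau> + 64 * \<delta>;
                l = idempotent_length (\<circ>\<^sub>J) A
            in A \<in> idempotent_products (\<circ>\<^sub>J) \<and>
               (A ** A = A \<longrightarrow> l = 1) \<and>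
               (A ** A \<noteq> A \<and> 4 * \<delta> = \<tau> * (\<tau> - 1) \<longrightarrow> l = 2) \<and>
               (4 * \<delta> \<noteq> \<tau> * (\<tau> - 1) \<and> is_square \<eta> \<longrightarrow> l = 3) \<and>
               (\<not> is_square \<eta> \<and> \<tau> \<noteq> - 1 / 8 \<longrightarrow> l = 4) \<and>
               (\<not> is_square \<eta> \<and> \<tau> = - 1 / 8 \<longrightarrow> l = 5)))
       \<and> (quadratically_closed TYPE('a) \<longrightarrow>
            idempotent_width ((\<circ>\<^sub>J) :: 'a^2^2 \<Rightarrow> 'a^2^2 \<Rightarrow> 'a^2^2) = 3)
       \<and> (\<not> quadratically_closed TYPE('a) \<longrightarrow>
            idempotent_width ((\<circ>\<^sub>J) :: 'a^2^2 \<Rightarrow> 'a^2^2 \<Rightarrow> 'a^2^2) = 5)"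
proof -
  note two = char_ne_2
  note len = idempotent_length_nonscalar[OF two]
  have "\<forall>A :: 'a^2^2. (\<nexists>c. A = mat c) \<longrightarrow>
           (let \<tau> = trace A; \<delta> = det A; \<eta> = 1 + 8 * \<tau> + 64 * \<delta>;
                l = idempotent_length (\<circ>\<^sub>J) A
            in A \<in> idempotent_products (\<circ>\<^sub>J) \<and>
               (A ** A = A \<longrightarrow> l = 1) \<and>
               (A ** A \<noteq> A \<and> 4 * \<delta> = \<tau> * (\<tau> - 1) \<longrightarrow> l = 2) \<and>
               (4 * \<delta> \<noteq> \<tau> * (\<tau> - 1) \<and> is_square \<eta> \<longrightarrow> l = 3) \<and>
               (\<not> is_square \<eta> \<and> \<tau> \<noteq> - 1 / 8 \<longrightarrow> l = 4) \<and>
               (\<not> is_square \<eta> \<and> \<tau> = - 1 / 8 \<longrightarrow> l = 5))"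
    unfolding Let_def scalar_def[symmetric]
    using len nonscalar_in_idempotent_products[OF two] by blast
  moreover have "idempotent_width ((\<circ>\<^sub>J) :: 'a^2^2 \<Rightarrow> 'a^2^2 \<Rightarrow> 'a^2^2) = 3"
    if "quadratically_closed TYPE('a)"
  proof -
    have sq: "is_square x" for x :: 'a
      using that quadratically_closed_iff[OF two] by blast
    have "idempotent_length (\<circ>\<^sub>J) A \<le> 3" if "A \<in> idempotent_products (\<circ>\<^sub>J)" for A :: "'a^2^2"
    proof (cases "scalar A")
      case True
      then show ?thesis using idempotent_length_scalar[OF two _ that] by simp
    next
      case False
      then have "idempotent_length (\<circ>\<^sub>J) A \<in> {1, 2, 3}"
        using len(1-3)[OF False] sq by blast
      then show ?thesis by auto
    qed
    \<comment> \<open>trace \<open>0\<close> and determinant \<open>1\<close>, which violates \<open>4\<delta> = \<tau>(\<tau> - 1)\<close>\<close>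
    moreover define A where "A = mat22 0 (- 1) 1 (0 :: 'a)"
    have A: "\<not> scalar A" by (simp add: A_def scalar_mat22)
    moreover have "idempotent_length (\<circ>\<^sub>J) A = 3"
      using sq four_eight_neq_0[OF two]
      by (intro len(3)[OF A]) (auto simp: A_def trace_mat22 det_mat22)
    ultimately have "idempotent_width ((\<circ>\<^sub>J) :: 'a^2^2 \<Rightarrow> 'a^2^2 \<Rightarrow> 'a^2^2) = enat 3"
      using nonscalar_in_idempotent_products[OF two A] by (intro idempotent_width_eqI)
    then show ?thesis by (simp add: numeral_eq_enat)
  qed
  moreover have "idempotent_width ((\<circ>\<^sub>J) :: 'a^2^2 \<Rightarrow> 'a^2^2 \<Rightarrow> 'a^2^2) = 5"
    if "\<not> quadratically_closed TYPE('a)"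
  proof -
    obtain x :: 'a where x: "\<not> is_square x"
      using \<open>\<not> quadratically_closed TYPE('a)\<close> quadratically_closed_iff[OF two] by blast
    have "idempotent_length (\<circ>\<^sub>J) A \<le> 5" if "A \<in> idempotent_products (\<circ>\<^sub>J)" for A :: "'a^2^2"
    proof (cases "scalar A")
      case True
      then show ?thesis using idempotent_length_scalar[OF two _ that] by simp
    next
      case False
      then have "idempotent_length (\<circ>\<^sub>J) A \<in> {1, 2, 3, 4, 5}"
        using len[OF False] by blast
      then show ?thesis by auto
    qed
    \<comment> \<open>trace \<open>-1/8\<close> and determinant \<open>x\<close>, so that \<open>\<eta> = 64x\<close> is no square\<close>
    moreover define A where "A = mat22 (- 1 / 8) (- x) 1 (0 :: 'a)"
    have A: "\<not> scalar A" by (simp add: A_def scalar_mat22)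
    moreover have "idempotent_length (\<circ>\<^sub>J) A = 5"
    proof (rule len(5)[OF A])
      show "trace A = - 1 / 8" by (simp add: A_def trace_mat22)
      then have "8 * trace A = -1" using four_eight_neq_0[OF two] by simp
      then have "1 + 8 * trace A + 64 * det A = 4 * (4 * (4 * x))"
        by (simp add: A_def det_mat22)
      then show "\<not> is_square (1 + 8 * trace A + 64 * det A)"
        using x by (simp only: is_square_4_mult[OF two] not_False_eq_True)
    qed
    ultimately have "idempotent_width ((\<circ>\<^sub>J) :: 'a^2^2 \<Rightarrow> 'a^2^2 \<Rightarrow> 'a^2^2) = enat 5"
      using nonscalar_in_idempotent_products[OF two A] by (intro idempotent_width_eqI)
    then show ?thesis by (simp add: numeral_eq_enat)
  qed
  ultimately show ?thesis by blast
qed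

end
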